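(* Every simple automorphic $2$-loop is commutative and has exponent $2$ (i.e. $x^2=1$ for all $x$).
   Context: A loop is a set with a binary operation in which left and right division are uniquely solvable and which has a neutral element $1$. $\mathrm{Mlt}(Q)$ is the group generated by all left and right translations, $\mathrm{Inn}(Q)$ the stabilizer of $1$ in it; $Q$ is automorphic if $\mathrm{Inn}(Q)\le\mathrm{Aut}(Q)$ (automorphic loops are power-associative). A $2$-loop is a finite loop of order $2^m$, $m\ge 1$. A loop is simple if its only normal subloops (kernels of homomorphisms) are $1$ and itself. *)

theory Defs
  imports "HOL-Algebra.Bij" "HOL-Algebra.Generated_Groups"
begin

definition loop :: "'a set \<Rightarrow> ('a \<Rightarrow> 'a \<Rightarrow> 'a) \<Rightarrow> 'a \<Rightarrow> bool" where
  "loop Q m e \<longleftrightarrow>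
     (\<forall>x\<in>Q. \<forall>y\<in>Q. m x y \<in> Q) \<and> e \<in> Q \<and>
     (\<forall>x\<in>Q. m e x = x \<and> m x e = x) \<and>
     (\<forall>a\<in>Q. \<forall>b\<in>Q. \<exists>!x. x \<in> Q \<and> m a x = b) \<and>
     (\<forall>a\<in>Q. \<forall>b\<in>Q. \<exists>!y. y \<in> Q \<and> m y a = b)"

text \<open>Left and right translations, as elements of the symmetric group BijGroup Q.\<close>

definition Ltr :: "'a set \<Rightarrow> ('a \<Rightarrow> 'a \<Rightarrow> 'a) \<Rightarrow> 'a \<Rightarrow> ('a \<Rightarrow> 'a)" where
  "Ltr Q m a = restrict (\<lambda>x. m a x) Q"

definition Rtr :: "'a set \<Rightarrow> ('a \<Rightarrow> 'a \<Rightarrow> 'a) \<Rightarrow> 'a \<Rightarrow> ('a \<Rightarrow> 'a)" where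
  "Rtr Q m a = restrict (\<lambda>x. m x a) Q"

definition Mlt :: "'a set \<Rightarrow> ('a \<Rightarrow> 'a \<Rightarrow> 'a) \<Rightarrow> ('a \<Rightarrow> 'a) set" where
  "Mlt Q m = generate (BijGroup Q) ((Ltr Q m ` Q) \<union> (Rtr Q m ` Q))"

definition Inn :: "'a set \<Rightarrow> ('a \<Rightarrow> 'a \<Rightarrow> 'a) \<Rightarrow> 'a \<Rightarrow> ('a \<Rightarrow> 'a) set" where
  "Inn Q m e = {f \<in> Mlt Q m. f e = e}"

definition loop_hom :: "'a set \<Rightarrow> ('a \<Rightarrow> 'a \<Rightarrow> 'a) \<Rightarrow> 'b set \<Rightarrow> ('b \<Rightarrow> 'b \<Rightarrow> 'b) \<Rightarrow> ('a \<Rightarrow> 'b) \<Rightarrow> bool" where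
  "loop_hom Q m Q' m' f \<longleftrightarrow> f ` Q \<subseteq> Q' \<and> (\<forall>x\<in>Q. \<forall>y\<in>Q. f (m x y) = m' (f x) (f y))"

text \<open>Automorphic: every inner mapping is an automorphism (inner mappings are already
  bijections of Q, so it suffices that they are multiplicative).\<close>

definition automorphic_loop :: "'a set \<Rightarrow> ('a \<Rightarrow> 'a \<Rightarrow> 'a) \<Rightarrow> 'a \<Rightarrow> bool" where
  "automorphic_loop Q m e \<longleftrightarrow> loop Q m e \<and>
     (\<forall>f\<in>Inn Q m e. bij_betw f Q Q \<and> loop_hom Q m Q m f)"

text \<open>Normal subloop = kernel of a loop homomorphism.  Every kernel is the kernel of the
  canonical map onto the quotient loop, whose elements are subsets of Q; hence it suffices
  to let the target loop range over loops whose carrier consists of sets of elements of 'a.\<close>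

definition normal_subloop :: "'a set \<Rightarrow> ('a \<Rightarrow> 'a \<Rightarrow> 'a) \<Rightarrow> 'a \<Rightarrow> 'a set \<Rightarrow> bool" where
  "normal_subloop Q m e N \<longleftrightarrow>
     (\<exists>(Q' :: 'a set set) m' e' f. loop Q' m' e' \<and> loop_hom Q m Q' m' f \<and>
        N = {x \<in> Q. f x = e'})"

definition simple_loop :: "'a set \<Rightarrow> ('a \<Rightarrow> 'a \<Rightarrow> 'a) \<Rightarrow> 'a \<Rightarrow> bool" where
  "simple_loop Q m e \<longleftrightarrow> loop Q m e \<and>
     (\<forall>N. normal_subloop Q m e N \<longrightarrow> N = {e} \<or> N = Q)"

definition two_loop :: "'a set \<Rightarrow> ('a \<Rightarrow> 'a \<Rightarrow> 'a) \<Rightarrow> 'a \<Rightarrow> bool" where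
  "two_loop Q m e \<longleftrightarrow> loop Q m e \<and> finite Q \<and> (\<exists>k::nat. k \<ge> 1 \<and> card Q = 2 ^ k)"

end

theory Submission
  imports Defs "HOL-Algebra.Group_Action" "HOL-Algebra.Sylow"
begin

text \<open>
  An automorphic loop has the antiautomorphic inverse property, so the inversion map \<open>J\<close>
  normalizes the multiplication group; let \<open>M\<close> be the group generated by both.
  The stabilizer of \<open>1\<close> in \<open>M\<close> centralizes \<open>J\<close>.  As the degree is a power of 2, a Sylow
  2-subgroup \<open>P\<close> of \<open>M\<close> is transitive; it contains \<open>J\<close>, and the \<open>M\<close>-conjugates of \<open>J\<close>
  are already its \<open>P\<close>-conjugates.  The stabilizer of \<open>1\<close> in \<open>P\<close> lies in a proper normal subgroup \<open>Y\<close>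
  of \<open>P\<close>, which is intransitive and contains all conjugates of \<open>J\<close>.  Hence the normal closure of \<open>J\<close> in \<open>M\<close>
  is intransitive, and simplicity forces it to fix \<open>1\<close>.  The conjugate of \<open>J\<close> by the right
  translation \<open>R\<^sub>x\<close> maps \<open>1\<close> to \<open>x\<^sup>2\<close>, so the exponent is 2, and then the antiautomorphic
  inverse property is commutativity.
\<close>

section \<open>Actions of 2-groups\<close>

text \<open>Orbit sizes divide \<open>2 ^ n\<close>, so an orbit of odd size is a single fixed
  point, while the parity of \<open>card E\<close> is that of the number of odd orbits.\<close>

lemma (in group_action) even_card_fixed_points_iff:
  assumes ord: "order G = 2 ^ n" and fin: "finite E"
  shows "even (card {x \<in> E. \<forall>g\<in>carrier G. \<phi> g x = x}) \<longleftrightarrow> even (card E)"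
proof -
  interpret group G using group_hom group_hom.axioms(1) by auto
  let ?F = "{x \<in> E. \<forall>g\<in>carrier G. \<phi> g x = x}"
  have finO: "finite (orbits G E \<phi>)" using fin unfolding orbits_def by simp
  have "card E = (\<Sum>orb\<in>orbits G E \<phi>. card orb)"
    using disjoint_sum[OF fin, of "\<lambda>_. 1::nat"] by simp
  hence E: "even (card E) \<longleftrightarrow> even (card {orb \<in> orbits G E \<phi>. odd (card orb)})"
    using even_sum_iff[OF finO, of card] by simp
  have "{orb \<in> orbits G E \<phi>. odd (card orb)} = (\<lambda>x. {x}) ` ?F"
  proof (intro equalityI subsetI)
    fix orb assume "orb \<in> {orb \<in> orbits G E \<phi>. odd (card orb)}"
    then obtain x where x: "x \<in> E" "orb = orbit G \<phi> x" "odd (card (orbit G \<phi> x))"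
      unfolding orbits_def by auto
    have "card (orbit G \<phi> x) dvd 2 ^ n"
      using orbit_stabilizer_theorem[OF x(1)] ord by (metis dvd_triv_left)
    then have "card (orbit G \<phi> x) = 1"
      using x(3) by (metis divides_primepow_nat dvd_power even_power
          neq0_conv power_0 two_is_prime_nat dvd_refl)
    then obtain z where z: "orbit G \<phi> x = {z}" by (meson card_1_singletonE)
    then have "orbit G \<phi> x = {x}" using orbit_refl[OF x(1)] by auto
    then show "orb \<in> (\<lambda>x. {x}) ` ?F" using x unfolding orbit_def by blast
  next
    fix orb assume "orb \<in> (\<lambda>x. {x}) ` ?F"
    then obtain x where x: "x \<in> ?F" "orb = {x}" by auto
    then have "orbit G \<phi> x = {x}" using orbit_refl unfolding orbit_def by auto
    then show "orb \<in> {orb \<in> orbits G E \<phi>. odd (card orb)}"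
      using x unfolding orbits_def by auto
  qed
  moreover have "card ((\<lambda>x. {x}) ` ?F) = card ?F" by (simp add: card_image)
  ultimately show ?thesis using E by simp
qed

text \<open>Right multiplication lets the 2-group \<open>A\<close> act on the right cosets of
  \<open>H\<close>; a coset \<open>H #> g\<close> is fixed exactly when
  \<open>g \<otimes> a \<otimes> inv g\<close> lies in \<open>H\<close> for all \<open>a\<close> in
  \<open>A\<close>. Parity thus produces such a \<open>g\<close>, both for \<open>A = H\<close> and
  for \<open>A = {\<one>, j}\<close> with \<open>H\<close> a Sylow 2-subgroup.\<close>

lemma (in group) even_card_fixed_rcosets_iff:
  assumes fin: "finite (carrier G)" and A: "subgroup A G" "card A = 2 ^ n" and H: "subgroup H G"
  shows "even (card {C \<in> rcosets H. \<forall>a\<in>A. C #> a = C}) \<longleftrightarrow> even (card (rcosets H))"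
proof -
  \<comment> \<open>The inverse turns right multiplication into a left action; the domain is bounded
    because elements of \<open>BijGroup\<close> are extensional.\<close>
  let ?\<phi> = "\<lambda>a. \<lambda>C\<in>rcosets H. C #> inv a"
  have Ac: "a \<in> carrier G" if "a \<in> A" for a using subgroup.mem_carrier[OF A(1) that] .
  have ia: "inv a \<in> A" if "a \<in> A" for a using subgroup.m_inv_closed[OF A(1) that] .
  have Cc: "C \<subseteq> carrier G" if "C \<in> rcosets H" for C
    using rcosets_part_G[OF H] that by auto
  have cl: "C #> g \<in> rcosets H" if "C \<in> rcosets H" "g \<in> carrier G" for C g
    using that H unfolding RCOSETS_def
    by (auto simp: coset_mult_assoc subgroup.subset)
  have rr: "(C #> g) #> h = C #> (g \<otimes> h)" if "C \<in> rcosets H" "g \<in> carrier G" "h \<in> carrier G" for C g h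
    using that Cc coset_mult_assoc by simp
  have one: "C #> \<one> = C" if "C \<in> rcosets H" for C using that Cc by simp
  have bij: "?\<phi> a \<in> Bij (rcosets H)" if a: "a \<in> A" for a
    unfolding Bij_def
  proof (intro IntI CollectI)
    show "bij_betw (?\<phi> a) (rcosets H) (rcosets H)"
      by (rule bij_betw_byWitness[where f'="\<lambda>C. C #> a"])
         (use a Ac in \<open>auto simp: cl rr one\<close>)
  qed auto
  have grp: "group (G\<lparr>carrier := A\<rparr>)" using A(1) subgroup_imp_group by blast
  interpret act: group_action "G\<lparr>carrier := A\<rparr>" "rcosets H" ?\<phi>
  proof (intro group_action.intro group_hom.intro group_hom_axioms.intro grp group_BijGroup homI)
    fix a assume "a \<in> carrier (G\<lparr>carrier := A\<rparr>)"
    then show "?\<phi> a \<in> carrier (BijGroup (rcosets H))" using bij by (simp add: BijGroup_def)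
  next
    fix a b assume "a \<in> carrier (G\<lparr>carrier := A\<rparr>)" "b \<in> carrier (G\<lparr>carrier := A\<rparr>)"
    then have ab: "a \<in> A" "b \<in> A" by auto
    have "?\<phi> (a \<otimes> b) = compose (rcosets H) (?\<phi> a) (?\<phi> b)"
      using ab Ac by (auto simp: compose_def fun_eq_iff cl rr inv_mult_group)
    then show "?\<phi> (a \<otimes>\<^bsub>G\<lparr>carrier := A\<rparr>\<^esub> b) = ?\<phi> a \<otimes>\<^bsub>BijGroup (rcosets H)\<^esub> ?\<phi> b"
      using ab bij by (simp add: BijGroup_def)
  qed
  have "finite (rcosets H)" using fin H by (simp add: RCOSETS_def)
  from act.even_card_fixed_points_iff[OF _ this, of n]
  have "even (card {C \<in> rcosets H. \<forall>a\<in>A. ?\<phi> a C = C}) \<longleftrightarrow> even (card (rcosets H))"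
    using A(2) by (simp add: order_def)
  moreover have "{C \<in> rcosets H. \<forall>a\<in>A. ?\<phi> a C = C} = {C \<in> rcosets H. \<forall>a\<in>A. C #> a = C}"
    using ia Ac by (auto) (metis inv_inv)+
  ultimately show ?thesis by simp
qed

text \<open>Let \<open>Y\<close> act on its own right cosets. Their number is a power of 2 other
  than 1, so the number of fixed cosets is even. As \<open>Y\<close> itself is fixed, there is
  another fixed coset \<open>Y #> g\<close>, and \<open>g\<close> conjugates \<open>Y\<close> into
  itself.\<close>

lemma (in group) subgroup_order_2_pow_normalizer_grows:
  assumes fin: "finite (carrier G)" and ord: "order G = 2 ^ n"
    and Y: "subgroup Y G" "Y \<noteq> carrier G"
  obtains g where "g \<in> carrier G" "g \<notin> Y" "\<And>y. y \<in> Y \<Longrightarrow> g \<otimes> y \<otimes> inv g \<in> Y"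
proof -
  have Yc: "Y \<subseteq> carrier G" using Y(1) subgroup.subset by blast
  have lag: "card (rcosets Y) * card Y = 2 ^ n" using lagrange[OF Y(1)] ord by simp
  obtain k where k: "card Y = 2 ^ k"
    using lag by (metis divides_primepow_nat dvd_triv_right two_is_prime_nat)
  obtain l where l: "card (rcosets Y) = 2 ^ l"
    using lag by (metis divides_primepow_nat dvd_triv_left two_is_prime_nat)
  have "l \<noteq> 0"
  proof
    assume "l = 0"
    then have "card Y = card (carrier G)" using lag l ord by (simp add: order_def)
    then show False using Y(2) Yc fin card_subset_eq by blast
  qed
  then have "even (card (rcosets Y))" using l by simp
  then have ev: "even (card {C \<in> rcosets Y. \<forall>a\<in>Y. C #> a = C})" (is "even (card ?F)")
    using even_card_fixed_rcosets_iff[OF fin Y(1) k Y(1)] by simp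
  have "Y \<in> ?F"
    using Y(1) rcosetsI[OF Yc one_closed] Yc
    by (auto simp: coset_join2 coset_mult_one subgroup.mem_carrier)
  moreover have "?F \<noteq> {Y}" using ev by auto
  ultimately obtain C where C: "C \<in> rcosets Y" "\<And>a. a \<in> Y \<Longrightarrow> C #> a = C" "C \<noteq> Y" by blast
  then obtain g where g: "g \<in> carrier G" "C = Y #> g" unfolding RCOSETS_def by auto
  have "g \<notin> Y" using C(3) g Y(1) by (auto simp: coset_join2)
  moreover have "g \<otimes> y \<otimes> inv g \<in> Y" if y: "y \<in> Y" for y
  proof -
    have "g \<in> C" using g Y(1) by (simp add: rcos_self)
    then have "g \<otimes> y \<in> C" using C(2)[OF y] unfolding r_coset_def by blast
    then obtain z where "z \<in> Y" "g \<otimes> y = z \<otimes> g" using g unfolding r_coset_def by auto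
    then show ?thesis using g(1) Yc y by (metis inv_solve_right m_closed subsetD)
  qed
  ultimately show ?thesis using that g(1) by blast
qed

text \<open>Any \<open>Y\<close> maximal among the proper subgroups containing \<open>H\<close>
  works: its normalizer is strictly larger, hence the whole group.\<close>

lemma (in group) order_2_pow_proper_normal_subgroup:
  assumes fin: "finite (carrier G)" and ord: "order G = 2 ^ n"
    and H: "subgroup H G" "H \<noteq> carrier G"
  obtains Y where "subgroup Y G" "Y \<noteq> carrier G" "H \<subseteq> Y"
    "\<And>g y. g \<in> carrier G \<Longrightarrow> y \<in> Y \<Longrightarrow> g \<otimes> y \<otimes> inv g \<in> Y"
proof -
  let ?S = "{Y. subgroup Y G \<and> Y \<noteq> carrier G \<and> H \<subseteq> Y}"
  have "?S \<subseteq> Pow (carrier G)" using subgroup.subset by blast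
  then have "finite ?S" using fin by (meson finite_Pow_iff finite_subset)
  moreover have "H \<in> ?S" using H by blast
  ultimately obtain Y where Y: "Y \<in> ?S" "\<And>Z. Z \<in> ?S \<Longrightarrow> Y \<subseteq> Z \<Longrightarrow> Y = Z"
    using finite_has_maximal[of ?S] by (metis (no_types, lifting) empty_iff)
  have sY: "subgroup Y G" using Y(1) by simp
  then have Yc: "Y \<subseteq> carrier G" by (rule subgroup.subset)
  have iY: "inv y \<in> Y" if "y \<in> Y" for y using subgroup.m_inv_closed[OF sY that] .
  have mY: "y \<otimes> z \<in> Y" if "y \<in> Y" "z \<in> Y" for y z using subgroup.m_closed[OF sY that] .
  let ?N = "{g \<in> carrier G. \<forall>y\<in>Y. g \<otimes> y \<otimes> inv g \<in> Y}"
  have cj: "(g \<otimes> h) \<otimes> y \<otimes> inv (g \<otimes> h) = g \<otimes> (h \<otimes> y \<otimes> inv h) \<otimes> inv g"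
    if "g \<in> carrier G" "h \<in> carrier G" "y \<in> carrier G" for g h y
    using that by (simp add: m_assoc inv_mult_group)
  have "subgroup ?N G"
  proof (rule subgroupI)
    have "\<one> \<in> ?N" using Yc by auto
    then show "?N \<noteq> {}" by blast
    show "g \<otimes> h \<in> ?N" if "g \<in> ?N" "h \<in> ?N" for g h
      using that Yc cj by auto
    show "inv g \<in> ?N" if g: "g \<in> ?N" for g
    proof -
      \<comment> \<open>Membership in \<open>?N\<close> only says that conjugation by
        \<open>g\<close> maps \<open>Y\<close> into itself. Since \<open>Y\<close> is finite, this
        injective map is onto, so conjugation by \<open>inv g\<close> also maps \<open>Y\<close>
        into itself.\<close>
      let ?c = "\<lambda>y. g \<otimes> y \<otimes> inv g"
      have "inj_on ?c Y" using g Yc by (auto simp: inj_on_def subsetD)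
      moreover have "?c ` Y \<subseteq> Y" using g by auto
      moreover have "finite Y" using Yc fin finite_subset by blast
      ultimately have im: "?c ` Y = Y" using endo_inj_surj by blast
      have "inv g \<otimes> y \<otimes> inv (inv g) \<in> Y" if "y \<in> Y" for y
      proof -
        have "y \<in> ?c ` Y" using im that by simp
        then obtain z where z: "z \<in> Y" "y = g \<otimes> z \<otimes> inv g" by (rule imageE)
        have "z \<in> carrier G" "g \<in> carrier G" using z Yc g by auto
        then have "inv g \<otimes> y \<otimes> inv (inv g) = z"
          unfolding z(2) by (simp add: m_assoc) (simp add: m_assoc[symmetric])
        then show ?thesis using z by simp
      qed
      then show ?thesis using g by auto
    qed
  qed auto
  moreover have "Y \<subseteq> ?N" using Yc iY mY by auto
  moreover have "\<exists>g\<in>?N. g \<notin> Y"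
    by (rule subgroup_order_2_pow_normalizer_grows[OF fin ord sY]) (use Y(1) in auto)
  ultimately have "?N = carrier G" using Y(2)[of ?N] Y(1) by auto
  then show ?thesis using that[of Y] Y(1) by auto
qed

section \<open>Sylow 2-subgroups of transitive groups of 2-power degree\<close>

lemma (in group_action) subgroup_action:
  assumes "subgroup H G"
  shows "group_action (G\<lparr>carrier := H\<rparr>) E \<phi>"
proof (intro group_action.intro group_hom.intro group_hom_axioms.intro group_BijGroup)
  interpret h: group_hom G "BijGroup E" \<phi> by (rule group_hom)
  show "group (G\<lparr>carrier := H\<rparr>)" by (rule group.subgroup_imp_group[OF h.G.is_group assms])
  show "\<phi> \<in> hom (G\<lparr>carrier := H\<rparr>) (BijGroup E)"
    using subgroup.subset[OF assms] by (intro homI) (auto simp: subsetD)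
qed

text \<open>This is meant for \<open>j\<close> the inversion map and \<open>x\<close> the neutral
  element of a loop. The conjugates of \<open>j\<close> all lie in a proper normal subgroup
  \<open>Y\<close> of a Sylow 2-subgroup \<open>P\<close>, and \<open>Y\<close> contains the
  stabilizer of \<open>x\<close> in \<open>P\<close>. A point that is not reached is then
  \<open>\<phi> p x\<close> for any \<open>p\<close> in \<open>P\<close> outside
  \<open>Y\<close>.\<close>

lemma (in transitive_action) conjugates_of_central_involution_of_stabilizer_intransitive:
  assumes fin: "finite (carrier G)" and cardE: "card E = 2 ^ k" "k \<ge> 1" and x: "x \<in> E"
    and j: "j \<in> carrier G" "j \<otimes> j = \<one>" "\<phi> j x = x"
    and central: "\<And>g. g \<in> carrier G \<Longrightarrow> \<phi> g x = x \<Longrightarrow> g \<otimes> j = j \<otimes> g"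
  shows "\<exists>y\<in>E. \<forall>n\<in>generate G {g \<otimes> j \<otimes> inv g | g. g \<in> carrier G}. \<phi> n x \<noteq> y"
proof -
  interpret group G using group_hom group_hom.axioms(1) by auto
  have orbE: "orbit G \<phi> x = E"
    using unique_orbit[OF x] element_image[OF _ x] unfolding orbit_def by blast
  have os: "2 ^ k * card (stabilizer G \<phi> x) = order G"
    using orbit_stabilizer_theorem[OF x] orbE cardE by simp
  have pos: "order G > 0" using fin order_gt_0_iff_finite by simp
  obtain a m where am: "order G = 2 ^ a * m" "odd m"
    using pos by (metis multiplicity_decompose' neq0_conv not_prime_unit two_is_prime_nat)
  obtain P where P: "subgroup P G" "card P = 2 ^ a"
    using sylow_thm[OF two_is_prime_nat is_group am(1) fin] by blast
  have Pc: "P \<subseteq> carrier G" using P(1) by (rule subgroup.subset)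
  have finP: "finite P" using Pc fin finite_subset by blast
  let ?P = "G\<lparr>carrier := P\<rparr>"
  interpret act: group_action ?P E \<phi> by (rule subgroup_action[OF P(1)])
  interpret gP: group ?P using P(1) subgroup_imp_group by blast
  let ?S = "stabilizer ?P \<phi> x"
  have sS: "subgroup ?S ?P" by (rule act.stabilizer_subgroup[OF x])
  have osP: "card (orbit ?P \<phi> x) * card ?S = 2 ^ a"
    using act.orbit_stabilizer_theorem[OF x] P(2) by (simp add: order_def)
  have sSG: "subgroup ?S G" using sS P(1) incl_subgroup by blast
  \<comment> \<open>This makes \<open>2 ^ k * card ?S\<close> a divisor of \<open>order G\<close>.
    Being a power of 2, it divides \<open>2 ^ a\<close>, so the orbit of \<open>x\<close> under
    \<open>P\<close> has at least \<open>2 ^ k\<close> points and is all of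
    \<open>E\<close>.\<close>
  have "card ?S dvd card (stabilizer G \<phi> x)"
  proof -
    have sub: "?S \<subseteq> stabilizer G \<phi> x" using Pc unfolding stabilizer_def by auto
    have st: "subgroup (stabilizer G \<phi> x) G" by (rule stabilizer_subgroup[OF x])
    have "subgroup ?S (G\<lparr>carrier := stabilizer G \<phi> x\<rparr>)"
      by (rule subgroup_incl[OF sSG st sub])
    from group.lagrange[OF subgroup_imp_group[OF st] this, symmetric] show ?thesis
      by (simp add: order_def)
  qed
  then have "2 ^ k * card ?S dvd 2 ^ a * m" using os am by (metis dvd_refl mult_dvd_mono)
  moreover obtain b where b: "card ?S = 2 ^ b"
    using osP by (metis divides_primepow_nat dvd_triv_right two_is_prime_nat)
  ultimately have "2 ^ (k + b) dvd 2 ^ a * m" by (simp add: power_add)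
  moreover have "coprime (2 ^ (k + b)) m" using am(2) by simp
  ultimately have "2 ^ (k + b) dvd (2 ^ a :: nat)" using coprime_dvd_mult_left_iff by blast
  then have kb: "k + b \<le> a" by (simp add: power_dvd_imp_le)
  obtain c where c: "card (orbit ?P \<phi> x) = 2 ^ c"
    using osP by (metis divides_primepow_nat dvd_triv_left two_is_prime_nat)
  have "c + b = a" using osP b c by (simp flip: power_add)
  then have "k \<le> c" using kb by simp
  then have "card E \<le> card (orbit ?P \<phi> x)" using cardE c by simp
  moreover have "orbit ?P \<phi> x \<subseteq> E" using act.element_image[OF _ x] unfolding orbit_def by blast
  moreover have finE: "finite E" using cardE by (metis card.infinite power_not_zero zero_neq_numeral)
  ultimately have orbP: "orbit ?P \<phi> x = E" by (meson card_seteq)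
  \<comment> \<open>Frattini argument: by transitivity of \<open>P\<close>, some \<open>p\<close> in
    \<open>P\<close> agrees with \<open>g\<close> at \<open>x\<close>; then
    \<open>inv p \<otimes> g\<close> fixes \<open>x\<close> and so commutes with
    \<open>j\<close>.\<close>
  have factor: "\<exists>p\<in>P. \<exists>s\<in>carrier G. g = p \<otimes> s \<and> s \<otimes> j = j \<otimes> s" if g: "g \<in> carrier G" for g
  proof -
    have "\<phi> g x \<in> orbit ?P \<phi> x" using orbP element_image[OF g x] by simp
    then obtain p where p: "p \<in> P" "\<phi> p x = \<phi> g x" unfolding orbit_def by auto
    have pc: "p \<in> carrier G" using p Pc by blast
    have "\<phi> (inv p \<otimes> g) x = x"
      using composition_rule[OF x _ g] orbit_sym_aux[OF pc x p(2)] pc by simp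
    then have "(inv p \<otimes> g) \<otimes> j = j \<otimes> (inv p \<otimes> g)" using central pc g by simp
    moreover have "g = p \<otimes> (inv p \<otimes> g)" using pc g by (simp add: m_assoc[symmetric])
    ultimately show ?thesis using p(1) pc g by (metis inv_closed m_closed)
  qed
  \<comment> \<open>The factor \<open>s\<close> cancels, so every conjugate of \<open>j\<close> is
    already a conjugate by an element of \<open>P\<close>.\<close>
  have conj: "g \<otimes> j \<otimes> inv g = p \<otimes> j \<otimes> inv p"
    if "p \<in> carrier G" "s \<in> carrier G" "g = p \<otimes> s" "s \<otimes> j = j \<otimes> s" for g p s
  proof -
    have "g \<otimes> j \<otimes> inv g = p \<otimes> (s \<otimes> j) \<otimes> (inv s \<otimes> inv p)"
      using that(1-3) j by (simp add: m_assoc inv_mult_group)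
    also have "\<dots> = p \<otimes> j \<otimes> (s \<otimes> (inv s \<otimes> inv p))"
      using that(1,2) j unfolding that(4) by (simp add: m_assoc)
    also have "s \<otimes> (inv s \<otimes> inv p) = inv p"
      using that(1,2) by (simp add: m_assoc[symmetric])
    finally show ?thesis .
  qed
  \<comment> \<open>The index \<open>m\<close> of \<open>P\<close> is odd, so
    \<open>{\<one>, j}\<close> fixes some coset \<open>P #> g\<close>, which puts
    \<open>g \<otimes> j \<otimes> inv g\<close> into \<open>P\<close>. This equals a conjugate of
    \<open>j\<close> by an element of \<open>P\<close>, and conjugating back stays in
    \<open>P\<close>.\<close>
  have jP: "j \<in> P"
  proof -
    let ?A = "{\<one>, j}"
    have invj: "inv j = j" using j by (simp add: inv_equality)
    have A: "subgroup ?A G" by (rule subgroupI) (use j invj in auto)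
    obtain r where r: "card ?A = 2 ^ r"
    proof (cases "j = \<one>")
      case True then show ?thesis using that[of 0] by simp
    next
      case False then show ?thesis using that[of 1] by simp
    qed
    have "card (rcosets P) * 2 ^ a = m * 2 ^ a" using lagrange[OF P(1)] P(2) am(1) by simp
    then have "odd (card (rcosets P))" using am(2) by simp
    then have "odd (card {C \<in> rcosets P. \<forall>b\<in>?A. C #> b = C})"
      using even_card_fixed_rcosets_iff[OF fin A r P(1)] by simp
    then have "{C \<in> rcosets P. \<forall>b\<in>?A. C #> b = C} \<noteq> {}" by (metis card.empty even_zero)
    then obtain C where C: "C \<in> rcosets P" "C #> j = C" by blast
    then obtain g where g: "g \<in> carrier G" "C = P #> g" unfolding RCOSETS_def by auto
    have "g \<in> C" using g P(1) by (simp add: rcos_self)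
    then have "g \<otimes> j \<in> C" using C(2) unfolding r_coset_def by blast
    then obtain z where z: "z \<in> P" "g \<otimes> j = z \<otimes> g" using g unfolding r_coset_def by auto
    then have gP: "g \<otimes> j \<otimes> inv g \<in> P" using g j Pc by (metis inv_solve_right m_closed subsetD)
    obtain p s where ps: "p \<in> P" "s \<in> carrier G" "g = p \<otimes> s" "s \<otimes> j = j \<otimes> s"
      using factor[OF g(1)] by blast
    have pc: "p \<in> carrier G" using ps Pc by blast
    have "p \<otimes> j \<otimes> inv p \<in> P" using gP conj[OF pc ps(2-4)] by simp
    then have "inv p \<otimes> (p \<otimes> j \<otimes> inv p) \<otimes> p \<in> P"
      using ps(1) P(1) by (simp add: subgroup.m_closed subgroup.m_inv_closed)
    moreover have "inv p \<otimes> (p \<otimes> j \<otimes> inv p) \<otimes> p = j"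
      using pc j by (simp add: m_assoc) (simp add: m_assoc[symmetric])
    ultimately show ?thesis by simp
  qed
  \<comment> \<open>Here \<open>k \<ge> 1\<close> enters: a group fixing \<open>x\<close> cannot be
    transitive on at least two points.\<close>
  have "?S \<noteq> P"
  proof
    assume "?S = P"
    then have "orbit ?P \<phi> x \<subseteq> {x}" unfolding orbit_def stabilizer_def by auto
    then have "card E \<le> 1" using orbP by (metis card_mono finite.emptyI finite.insertI is_singletonI is_singleton_altdef)
    moreover have "(2::nat) ^ 1 \<le> 2 ^ k" using cardE(2) by (intro power_increasing) auto
    ultimately show False using cardE(1) by simp
  qed
  then obtain Y where Y: "subgroup Y ?P" "Y \<noteq> P" "?S \<subseteq> Y"
    "\<And>g y. g \<in> P \<Longrightarrow> y \<in> Y \<Longrightarrow> g \<otimes> y \<otimes> inv g \<in> Y"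
    using gP.order_2_pow_proper_normal_subgroup[OF _ _ sS, of a] finP P
    by (auto simp: order_def m_inv_consistent)
  have YG: "subgroup Y G" using Y(1) P(1) incl_subgroup by blast
  have YP: "Y \<subseteq> P" using subgroup.subset[OF Y(1)] by simp
  have jY: "j \<in> Y" using Y(3) jP j(3) unfolding stabilizer_def by auto
  have "{g \<otimes> j \<otimes> inv g | g. g \<in> carrier G} \<subseteq> Y"
  proof clarify
    fix g assume "g \<in> carrier G"
    then obtain p s where ps: "p \<in> P" "s \<in> carrier G" "g = p \<otimes> s" "s \<otimes> j = j \<otimes> s"
      using factor by blast
    then show "g \<otimes> j \<otimes> inv g \<in> Y" using Y(4)[OF ps(1) jY] conj[of p s g] Pc by auto
  qed
  then have genY: "generate G {g \<otimes> j \<otimes> inv g | g. g \<in> carrier G} \<subseteq> Y"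
    using generate_subgroup_incl YG by blast
  obtain p where p: "p \<in> P" "p \<notin> Y" using Y(2) YP by blast
  have pc: "p \<in> carrier G" using p Pc by blast
  \<comment> \<open>Otherwise \<open>inv n \<otimes> p\<close> would lie in \<open>?S\<close>, hence
    in \<open>Y\<close>, forcing \<open>p\<close> into \<open>Y\<close>.\<close>
  have "\<phi> n x \<noteq> \<phi> p x" if n: "n \<in> Y" for n
  proof
    assume eq: "\<phi> n x = \<phi> p x"
    have nc: "n \<in> carrier G" using n YP Pc by blast
    have "\<phi> (inv n \<otimes> p) x = x"
      using composition_rule[OF x _ pc] orbit_sym_aux[OF nc x eq] nc by simp
    moreover have "inv n \<otimes> p \<in> P"
      using n YP p(1) P(1) by (meson subgroup.m_closed subgroup.m_inv_closed subsetD)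
    ultimately have "inv n \<otimes> p \<in> Y" using Y(3) unfolding stabilizer_def by auto
    then have "n \<otimes> (inv n \<otimes> p) \<in> Y" by (rule subgroup.m_closed[OF YG n])
    then show False using p(2) nc pc by (simp add: m_assoc[symmetric])
  qed
  then show ?thesis using genY element_image[OF pc x] by blast
qed

text \<open>Since \<open>j\<close> is its own inverse, \<open>norm\<close> says that
  \<open>j\<close> normalizes \<open>H\<close>. Every \<open>h \<otimes> j\<close> can then be
  rewritten as \<open>j \<otimes> h'\<close> with \<open>h'\<close> in \<open>H\<close>, so products
  and inverses fall back into the two cosets, which coincide if \<open>j\<close> lies in
  \<open>H\<close>.\<close>

lemma (in group) subgroup_Un_involution_coset:
  assumes H: "subgroup H G" and j: "j \<in> carrier G" "j \<otimes> j = \<one>"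
    and norm: "\<And>h. h \<in> H \<Longrightarrow> j \<otimes> h \<otimes> j \<in> H"
  shows "subgroup (H \<union> (\<otimes>) j ` H) G"
proof (rule subgroupI)
  have invj: "inv j = j" using j by (simp add: inv_equality)
  have Hc: "h \<in> carrier G" if "h \<in> H" for h using subgroup.mem_carrier[OF H that] .
  have mH: "h \<otimes> h' \<in> H" if "h \<in> H" "h' \<in> H" for h h' using subgroup.m_closed[OF H that] .
  have iH: "inv h \<in> H" if "h \<in> H" for h using subgroup.m_inv_closed[OF H that] .
  have jj: "j \<otimes> (j \<otimes> h) = h" if "h \<in> carrier G" for h
    using j that by (simp add: m_assoc[symmetric])
  have flip: "\<exists>h'\<in>H. h \<otimes> j = j \<otimes> h'" if "h \<in> H" for h
    using that norm[OF that] j Hc[OF that] by (intro bexI[of _ "j \<otimes> h \<otimes> j"]) (auto simp: m_assoc jj)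
  show "H \<union> (\<otimes>) j ` H \<subseteq> carrier G" using Hc j by auto
  show "H \<union> (\<otimes>) j ` H \<noteq> {}" using subgroup.one_closed[OF H] by auto
  show "inv a \<in> H \<union> (\<otimes>) j ` H" if a: "a \<in> H \<union> (\<otimes>) j ` H" for a
  proof (cases "a \<in> H")
    case False
    then obtain h where h: "h \<in> H" "a = j \<otimes> h" using a by auto
    then have "inv a = inv h \<otimes> j" using j Hc invj by (simp add: inv_mult_group)
    then show ?thesis using flip[OF iH[OF h(1)]] by auto
  qed (use iH in auto)
  show "a \<otimes> b \<in> H \<union> (\<otimes>) j ` H" if a: "a \<in> H \<union> (\<otimes>) j ` H" and b: "b \<in> H \<union> (\<otimes>) j ` H" for a b
  proof -
    have *: "\<exists>h'\<in>H. h \<otimes> b = h' \<or> h \<otimes> b = j \<otimes> h'" if h: "h \<in> H" for h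
    proof (cases "b \<in> H")
      case False
      then obtain k where k: "k \<in> H" "b = j \<otimes> k" using b by auto
      obtain h' where h': "h' \<in> H" "h \<otimes> j = j \<otimes> h'" using flip[OF h] by auto
      have "h \<otimes> b = j \<otimes> (h' \<otimes> k)"
        using k h h' Hc j by (metis m_assoc)
      then show ?thesis using mH[OF h'(1) k(1)] by blast
    qed (use mH h in auto)
    show ?thesis
    proof (cases "a \<in> H")
      case True then show ?thesis using * by fastforce
    next
      case False
      then obtain h where h: "h \<in> H" "a = j \<otimes> h" using a by auto
      have bc: "b \<in> carrier G" using b Hc j by auto
      obtain h' where h': "h' \<in> H" "h \<otimes> b = h' \<or> h \<otimes> b = j \<otimes> h'" using *[OF h(1)] by blast
      have "a \<otimes> b = j \<otimes> (h \<otimes> b)" using h bc Hc j by (simp add: m_assoc)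
      then have "a \<otimes> b = j \<otimes> h' \<or> a \<otimes> b = h'" using h' jj Hc by auto
      then show ?thesis using h'(1) by auto
    qed
  qed
qed

section \<open>Automorphic loops\<close>

locale aut_loop =
  fixes Q :: "'a set" and m :: "'a \<Rightarrow> 'a \<Rightarrow> 'a" (infixl "\<cdot>" 70) and e :: 'a
  assumes automorphic: "automorphic_loop Q m e"
begin

section \<open>Divisions and inverses in a loop\<close>

definition ldiv :: "'a \<Rightarrow> 'a \<Rightarrow> 'a" where "ldiv a b = (THE x. x \<in> Q \<and> a \<cdot> x = b)"
definition rdiv :: "'a \<Rightarrow> 'a \<Rightarrow> 'a" where "rdiv b a = (THE x. x \<in> Q \<and> x \<cdot> a = b)"
text \<open>A right inverse by definition; \<open>left_iv\<close> shows that it is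
  two-sided.\<close>

definition iv :: "'a \<Rightarrow> 'a" where "iv a = ldiv a e"

lemma loop: "loop Q m e" using automorphic by (simp add: automorphic_loop_def)

lemma closed [simp]: "x \<in> Q \<Longrightarrow> y \<in> Q \<Longrightarrow> x \<cdot> y \<in> Q"
  and e_closed [simp]: "e \<in> Q"
  and left_neutral [simp]: "x \<in> Q \<Longrightarrow> e \<cdot> x = x"
  and right_neutral [simp]: "x \<in> Q \<Longrightarrow> x \<cdot> e = x"
  and ex1_ldiv: "a \<in> Q \<Longrightarrow> b \<in> Q \<Longrightarrow> \<exists>!x. x \<in> Q \<and> a \<cdot> x = b"
  and ex1_rdiv: "a \<in> Q \<Longrightarrow> b \<in> Q \<Longrightarrow> \<exists>!x. x \<in> Q \<and> x \<cdot> a = b"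
  using loop by (simp_all add: loop_def)

lemma ldiv_closed [simp]: "a \<in> Q \<Longrightarrow> b \<in> Q \<Longrightarrow> ldiv a b \<in> Q"
  and mult_ldiv [simp]: "a \<in> Q \<Longrightarrow> b \<in> Q \<Longrightarrow> a \<cdot> ldiv a b = b"
  using theI'[OF ex1_ldiv] unfolding ldiv_def by auto

lemma rdiv_closed [simp]: "a \<in> Q \<Longrightarrow> b \<in> Q \<Longrightarrow> rdiv b a \<in> Q"
  and mult_rdiv [simp]: "a \<in> Q \<Longrightarrow> b \<in> Q \<Longrightarrow> rdiv b a \<cdot> a = b"
  using theI'[OF ex1_rdiv] unfolding rdiv_def by auto

lemma left_cancel [simp]: "a \<in> Q \<Longrightarrow> x \<in> Q \<Longrightarrow> y \<in> Q \<Longrightarrow> a \<cdot> x = a \<cdot> y \<longleftrightarrow> x = y"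
  using ex1_ldiv closed by metis

lemma right_cancel [simp]: "a \<in> Q \<Longrightarrow> x \<in> Q \<Longrightarrow> y \<in> Q \<Longrightarrow> x \<cdot> a = y \<cdot> a \<longleftrightarrow> x = y"
  using ex1_rdiv closed by metis

lemma ldiv_mult [simp]: "a \<in> Q \<Longrightarrow> b \<in> Q \<Longrightarrow> ldiv a (a \<cdot> b) = b"
  by (metis closed ldiv_closed mult_ldiv left_cancel)

lemma rdiv_mult [simp]: "a \<in> Q \<Longrightarrow> b \<in> Q \<Longrightarrow> rdiv (b \<cdot> a) a = b"
  by (metis closed rdiv_closed mult_rdiv right_cancel)

lemma iv_closed [simp]: "a \<in> Q \<Longrightarrow> iv a \<in> Q"
  and right_iv [simp]: "a \<in> Q \<Longrightarrow> a \<cdot> iv a = e"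
  unfolding iv_def by auto

section \<open>The multiplication group and its inner mappings\<close>

abbreviation G where "G \<equiv> BijGroup Q"

sublocale G: group G by (rule group_BijGroup)

lemma carrier_G: "carrier G = Bij Q" by (simp add: BijGroup_def)

lemma mult_apply: "f \<in> Bij Q \<Longrightarrow> g \<in> Bij Q \<Longrightarrow> x \<in> Q \<Longrightarrow> (f \<otimes>\<^bsub>G\<^esub> g) x = f (g x)"
  by (simp add: BijGroup_def compose_def)

lemma Bij_apply: "f \<in> Bij Q \<Longrightarrow> x \<in> Q \<Longrightarrow> f x \<in> Q"
  using Bij_imp_funcset by blast

lemma inv_apply: "f \<in> Bij Q \<Longrightarrow> x \<in> Q \<Longrightarrow> (inv\<^bsub>G\<^esub> f) (f x) = x"
  using mult_apply[of "inv\<^bsub>G\<^esub> f" f x] G.l_inv[of f] G.inv_closed[of f]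
  by (simp add: carrier_G) (simp add: BijGroup_def)

lemma Bij_eqI: "f \<in> Bij Q \<Longrightarrow> g \<in> Bij Q \<Longrightarrow> (\<And>x. x \<in> Q \<Longrightarrow> f x = g x) \<Longrightarrow> f = g"
  using extensionalityI Bij_imp_extensional by metis

lemma Ltr_Bij: "a \<in> Q \<Longrightarrow> Ltr Q m a \<in> Bij Q"
  unfolding Bij_def Ltr_def
  by (auto intro!: bij_betw_byWitness[where f'="ldiv a"])

lemma Rtr_Bij: "a \<in> Q \<Longrightarrow> Rtr Q m a \<in> Bij Q"
  unfolding Bij_def Rtr_def
  by (auto intro!: bij_betw_byWitness[where f'="\<lambda>x. rdiv x a"])

lemma translations_subset: "Ltr Q m ` Q \<union> Rtr Q m ` Q \<subseteq> carrier G"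
  using Ltr_Bij Rtr_Bij carrier_G by auto

lemma subgroup_Mlt: "subgroup (Mlt Q m) G"
  unfolding Mlt_def by (rule G.generate_is_subgroup[OF translations_subset])

lemma Mlt_Bij: "f \<in> Mlt Q m \<Longrightarrow> f \<in> Bij Q"
  using subgroup.mem_carrier[OF subgroup_Mlt] carrier_G by simp

lemma Ltr_Mlt: "a \<in> Q \<Longrightarrow> Ltr Q m a \<in> Mlt Q m"
  and Rtr_Mlt: "a \<in> Q \<Longrightarrow> Rtr Q m a \<in> Mlt Q m"
  unfolding Mlt_def by (auto intro: generate.incl)

text \<open>Members of \<open>Mlt Q m\<close> are extensional. This predicate compares functions on
  \<open>Q\<close> only, so that plain lambda terms built from translations and divisions can be
  treated as members.\<close>

definition mlt_map :: "('a \<Rightarrow> 'a) \<Rightarrow> bool" where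
  "mlt_map f \<longleftrightarrow> (\<exists>g\<in>Mlt Q m. \<forall>x\<in>Q. g x = f x)"

lemma mlt_map_left: "a \<in> Q \<Longrightarrow> mlt_map (\<lambda>x. a \<cdot> x)"
  unfolding mlt_map_def by (rule bexI[OF _ Ltr_Mlt]) (simp_all add: Ltr_def)

lemma mlt_map_right: "a \<in> Q \<Longrightarrow> mlt_map (\<lambda>x. x \<cdot> a)"
  unfolding mlt_map_def by (rule bexI[OF _ Rtr_Mlt]) (simp_all add: Rtr_def)

lemma mlt_map_inverse:
  assumes "mlt_map f" "\<And>x. x \<in> Q \<Longrightarrow> h x \<in> Q" "\<And>x. x \<in> Q \<Longrightarrow> f (h x) = x"
  shows "mlt_map h"
proof -
  obtain g where g: "g \<in> Mlt Q m" "\<forall>x\<in>Q. g x = f x" using assms(1) mlt_map_def by auto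
  have "(inv\<^bsub>G\<^esub> g) x = h x" if "x \<in> Q" for x
    using inv_apply[OF Mlt_Bij[OF g(1)] assms(2)[OF that]] g(2) assms(2,3) that by simp
  then show ?thesis
    unfolding mlt_map_def using subgroup.m_inv_closed[OF subgroup_Mlt g(1)] by blast
qed

lemma mlt_map_ldiv: "a \<in> Q \<Longrightarrow> mlt_map (\<lambda>x. ldiv a x)"
  by (rule mlt_map_inverse[OF mlt_map_left]) auto

lemma mlt_map_comp:
  assumes "mlt_map f" "mlt_map h"
  shows "mlt_map (\<lambda>x. f (h x))"
proof -
  obtain g k where g: "g \<in> Mlt Q m" "\<forall>x\<in>Q. g x = f x" and k: "k \<in> Mlt Q m" "\<forall>x\<in>Q. k x = h x"
    using assms mlt_map_def by auto
  have "(g \<otimes>\<^bsub>G\<^esub> k) x = f (h x)" if "x \<in> Q" for x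
    using that g k mult_apply[OF Mlt_Bij Mlt_Bij, of g k] Bij_apply[OF Mlt_Bij[OF k(1)] that] by simp
  then show ?thesis
    unfolding mlt_map_def using subgroup.m_closed[OF subgroup_Mlt g(1) k(1)] by blast
qed

text \<open>The form in which the automorphic hypothesis enters: each identity below comes from
  writing down a suitable product of translations and divisions that fixes \<open>e\<close>.\<close>

lemma inner_mult:
  assumes "mlt_map f" "f e = e" "x \<in> Q" "y \<in> Q"
  shows "f (x \<cdot> y) = f x \<cdot> f y"
proof -
  obtain g where g: "g \<in> Mlt Q m" "\<forall>x\<in>Q. g x = f x" using assms(1) mlt_map_def by auto
  then have "g \<in> Inn Q m e" using assms(2) by (simp add: Inn_def)
  then have "loop_hom Q m Q m g" using automorphic by (simp add: automorphic_loop_def)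
  then show ?thesis using g(2) assms by (simp add: loop_hom_def)
qed

lemma mlt_map_closed: "mlt_map f \<Longrightarrow> x \<in> Q \<Longrightarrow> f x \<in> Q"
  unfolding mlt_map_def using Bij_apply Mlt_Bij by metis

section \<open>Flexibility and the antiautomorphic inverse property\<close>

lemma iv_unique: "x \<in> Q \<Longrightarrow> y \<in> Q \<Longrightarrow> x \<cdot> y = e \<Longrightarrow> y = iv x"
  by (metis iv_closed right_iv left_cancel)

lemma inner_iv:
  assumes "mlt_map f" "f e = e" "x \<in> Q"
  shows "f (iv x) = iv (f x)"
  using assms by (metis iv_closed right_iv iv_unique inner_mult mlt_map_closed)

text \<open>The conjugation \<open>?T\<close> is an inner mapping fixing \<open>x\<close>, so it
  also fixes \<open>iv x\<close>; hence \<open>x\<close> and \<open>iv x\<close> commute.\<close>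

lemma left_iv [simp]:
  assumes x: "x \<in> Q"
  shows "iv x \<cdot> x = e"
proof -
  let ?T = "\<lambda>y. ldiv x (y \<cdot> x)"
  have "mlt_map ?T" by (intro mlt_map_comp[OF mlt_map_ldiv mlt_map_right] x)
  from inner_iv[OF this _ x] have "ldiv x (iv x \<cdot> x) = iv x"
    using x ldiv_mult[OF x, of e] by simp
  then show ?thesis using mult_ldiv[OF x, of "iv x \<cdot> x"] x by simp
qed

lemma iv_iv [simp]: "x \<in> Q \<Longrightarrow> iv (iv x) = x"
  using iv_unique[of "iv x" x] by simp

text \<open>Conjugation by \<open>x\<close> is multiplicative and fixes every \<open>u\<close>
  commuting with \<open>x\<close>. The cases of interest are \<open>u = x\<close> and
  \<open>u = iv x\<close>.\<close>

lemma conjugation_fixing: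
  assumes x: "x \<in> Q" and u: "u \<in> Q" "u \<cdot> x = x \<cdot> u" and y: "y \<in> Q"
  shows "ldiv x ((y \<cdot> u) \<cdot> x) = ldiv x (y \<cdot> x) \<cdot> u"
proof -
  let ?T = "\<lambda>y. ldiv x (y \<cdot> x)"
  have "mlt_map ?T" by (intro mlt_map_comp[OF mlt_map_ldiv mlt_map_right] x)
  from inner_mult[OF this _ y u(1)] show ?thesis
    using x u ldiv_mult[OF x, of e] by simp
qed

lemma flexible:
  assumes x: "x \<in> Q" and w: "w \<in> Q"
  shows "x \<cdot> (w \<cdot> x) = (x \<cdot> w) \<cdot> x"
proof -
  \<comment> \<open>Chosen so that \<open>?y \<cdot> x = x \<cdot> w\<close>, that is, conjugation
    by \<open>x\<close> sends \<open>?y\<close> to \<open>w\<close>.\<close>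
  let ?y = "rdiv (x \<cdot> w) x"
  have "ldiv x ((x \<cdot> w) \<cdot> x) = w \<cdot> x"
    using conjugation_fixing[OF x x refl, of ?y] x w by simp
  then show ?thesis using mult_ldiv[OF x, of "(x \<cdot> w) \<cdot> x"] x w by simp
qed

text \<open>The map \<open>?r\<close> fixes both \<open>e\<close> and \<open>x\<close>. Its
  multiplicativity at \<open>y \<cdot> x\<close>, after cancelling the last factor \<open>x\<close>,
  is the claim.\<close>

lemma right_translations_iv_commute:
  assumes x: "x \<in> Q" and y: "y \<in> Q"
  shows "(y \<cdot> x) \<cdot> iv x = (y \<cdot> iv x) \<cdot> x"
proof -
  let ?r = "\<lambda>z. (z \<cdot> iv x) \<cdot> x"
  have "mlt_map ?r"
    by (intro mlt_map_comp[of "\<lambda>z. z \<cdot> x" "\<lambda>z. z \<cdot> iv x"] mlt_map_right x iv_closed)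
  from inner_mult[OF this _ y x] have "((y \<cdot> x) \<cdot> iv x) \<cdot> x = ((y \<cdot> iv x) \<cdot> x) \<cdot> x"
    using x by simp
  then show ?thesis using x y by simp
qed

text \<open>As for \<open>flexible\<close>, with \<open>iv x\<close> as the commuting element; the
  right translations by \<open>x\<close> and \<open>iv x\<close> must then be interchanged.\<close>

lemma flexible_iv:
  assumes x: "x \<in> Q" and w: "w \<in> Q"
  shows "x \<cdot> (w \<cdot> iv x) = (x \<cdot> w) \<cdot> iv x"
proof -
  let ?y = "rdiv (x \<cdot> w) x"
  have "ldiv x ((?y \<cdot> iv x) \<cdot> x) = w \<cdot> iv x"
    using conjugation_fixing[OF x, of "iv x" ?y] x w by simp
  moreover have "(?y \<cdot> iv x) \<cdot> x = (x \<cdot> w) \<cdot> iv x"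
    using right_translations_iv_commute[OF x, of ?y] x w by simp
  ultimately show ?thesis using mult_ldiv[OF x, of "(x \<cdot> w) \<cdot> iv x"] x w by simp
qed

lemma iv_mult:
  assumes a: "a \<in> Q" and b: "b \<in> Q"
  shows "iv (a \<cdot> b) = iv b \<cdot> iv a"
proof -
  have *: "iv (iv a \<cdot> iv b) = b \<cdot> a" if a: "a \<in> Q" and b: "b \<in> Q" for a b
  proof -
    let ?l = "\<lambda>w. ldiv (a \<cdot> b) (a \<cdot> (b \<cdot> w))" and ?c = "\<lambda>w. b \<cdot> (w \<cdot> iv b)"
    let ?u = "ldiv b (iv a)"
    \<comment> \<open>The inner mapping ?l sends ?u to the inverse of a \<cdot> b, so it sends iv ?u to a \<cdot> b;
      evaluating it at iv ?u \<cdot> iv b in two ways gives the identity.\<close>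
    have l: "mlt_map ?l"
      by (intro mlt_map_comp[OF mlt_map_ldiv mlt_map_comp[OF mlt_map_left mlt_map_left]] a b closed)
    have c: "mlt_map ?c" by (intro mlt_map_comp[OF mlt_map_left mlt_map_right] b iv_closed)
    have le: "?l e = e" using a b ldiv_mult[of "a \<cdot> b" e] by simp
    have "?l ?u = iv (a \<cdot> b)" using a b by (simp add: iv_def)
    then have lz: "?l (iv ?u) = a \<cdot> b" using inner_iv[OF l le, of ?u] a b by simp
    have "?l (iv ?u \<cdot> iv b) = (a \<cdot> b) \<cdot> ldiv (a \<cdot> b) a"
      using inner_mult[OF l le, of "iv ?u" "iv b"] lz a b by simp
    then have "?l (iv ?u \<cdot> iv b) = a" using a b by simp
    then have "a \<cdot> (b \<cdot> (iv ?u \<cdot> iv b)) = (a \<cdot> b) \<cdot> a"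
      using a b mult_ldiv[of "a \<cdot> b" "a \<cdot> (b \<cdot> (iv ?u \<cdot> iv b))"] by simp
    \<comment> \<open>The inner mapping \<open>?c\<close> sends \<open>?u\<close> to
      \<open>(b \<cdot> ?u) \<cdot> iv b = iv a \<cdot> iv b\<close> by \<open>flexible_iv\<close>,
      and inner mappings respect inverses.\<close>
    moreover have "?c (iv ?u) = iv (iv a \<cdot> iv b)"
      using inner_iv[OF c, of ?u] flexible_iv[OF b, of ?u] a b by simp
    ultimately have "a \<cdot> iv (iv a \<cdot> iv b) = a \<cdot> (b \<cdot> a)" using flexible[OF a b] by simp
    then show ?thesis using a b by simp
  qed
  show ?thesis using arg_cong[OF *[OF b a], of iv] a b by simp
qed

section \<open>The inversion map and its action on the multiplication group\<close>

definition J :: "'a \<Rightarrow> 'a" where "J = restrict iv Q"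

lemma J_apply [simp]: "x \<in> Q \<Longrightarrow> J x = iv x"
  by (simp add: J_def)

lemma J_Bij: "J \<in> Bij Q"
  unfolding Bij_def J_def by (auto intro!: bij_betw_byWitness[where f'=iv])

lemma J_J: "J \<otimes>\<^bsub>G\<^esub> J = \<one>\<^bsub>G\<^esub>"
proof (rule Bij_eqI)
  show "J \<otimes>\<^bsub>G\<^esub> J \<in> Bij Q" "\<one>\<^bsub>G\<^esub> \<in> Bij Q"
    using G.m_closed[of J J] G.one_closed J_Bij by (simp_all add: carrier_G)
  show "(J \<otimes>\<^bsub>G\<^esub> J) x = \<one>\<^bsub>G\<^esub> x" if "x \<in> Q" for x
    using that J_Bij by (simp add: mult_apply) (simp add: BijGroup_def)
qed

text \<open>The antiautomorphic inverse property as a statement about permutations: conjugation by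
  \<open>J\<close> exchanges left and right translations.\<close>

lemma J_Ltr_J: "a \<in> Q \<Longrightarrow> J \<otimes>\<^bsub>G\<^esub> Ltr Q m a \<otimes>\<^bsub>G\<^esub> J = Rtr Q m (iv a)"
  and J_Rtr_J: "a \<in> Q \<Longrightarrow> J \<otimes>\<^bsub>G\<^esub> Rtr Q m a \<otimes>\<^bsub>G\<^esub> J = Ltr Q m (iv a)"
proof -
  have c: "J \<otimes>\<^bsub>G\<^esub> f \<otimes>\<^bsub>G\<^esub> J \<in> Bij Q" "J \<otimes>\<^bsub>G\<^esub> f \<in> Bij Q" if "f \<in> Bij Q" for f
    using that J_Bij G.m_closed carrier_G by auto
  assume a: "a \<in> Q"
  show "J \<otimes>\<^bsub>G\<^esub> Ltr Q m a \<otimes>\<^bsub>G\<^esub> J = Rtr Q m (iv a)"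
    using a c[OF Ltr_Bij[OF a]] J_Bij Ltr_Bij[OF a] Rtr_Bij[of "iv a"]
    by (intro Bij_eqI) (auto simp: mult_apply iv_mult Ltr_def Rtr_def)
  show "J \<otimes>\<^bsub>G\<^esub> Rtr Q m a \<otimes>\<^bsub>G\<^esub> J = Ltr Q m (iv a)"
    using a c[OF Rtr_Bij[OF a]] J_Bij Rtr_Bij[OF a] Ltr_Bij[of "iv a"]
    by (intro Bij_eqI) (auto simp: mult_apply iv_mult Ltr_def Rtr_def)
qed

text \<open>Conjugation by \<open>J\<close> preserves the generating set of translations, and it
  respects products and inverses because \<open>J\<close> is its own inverse.\<close>

lemma J_normalizes_Mlt:
  assumes "f \<in> Mlt Q m"
  shows "J \<otimes>\<^bsub>G\<^esub> f \<otimes>\<^bsub>G\<^esub> J \<in> Mlt Q m"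
  using assms unfolding Mlt_def
proof (induction rule: generate.induct)
  case one
  then show ?case using J_J J_Bij carrier_G generate.one by simp
next
  case (incl h)
  then have "J \<otimes>\<^bsub>G\<^esub> h \<otimes>\<^bsub>G\<^esub> J \<in> Ltr Q m ` Q \<union> Rtr Q m ` Q"
    by (auto simp: J_Ltr_J J_Rtr_J)
  then show ?case by (rule generate.incl)
next
  case (inv h)
  then have "J \<otimes>\<^bsub>G\<^esub> h \<otimes>\<^bsub>G\<^esub> J \<in> Ltr Q m ` Q \<union> Rtr Q m ` Q"
    by (auto simp: J_Ltr_J J_Rtr_J)
  then have "inv\<^bsub>G\<^esub> (J \<otimes>\<^bsub>G\<^esub> h \<otimes>\<^bsub>G\<^esub> J) \<in> generate G (Ltr Q m ` Q \<union> Rtr Q m ` Q)"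
    by (rule generate.inv)
  moreover have "h \<in> carrier G" "J \<in> carrier G" using inv translations_subset J_Bij carrier_G by auto
  moreover have "inv\<^bsub>G\<^esub> J = J" using G.inv_equality[OF J_J] J_Bij carrier_G by simp
  ultimately show ?case by (simp add: G.inv_mult_group G.m_assoc)
next
  case (eng h k)
  have c: "h \<in> carrier G" "k \<in> carrier G" "J \<in> carrier G"
    using eng(1,2) G.generate_in_carrier[OF translations_subset] J_Bij carrier_G by auto
  have jj: "J \<otimes>\<^bsub>G\<^esub> (J \<otimes>\<^bsub>G\<^esub> x) = x" if "x \<in> carrier G" for x
    using c that J_J by (simp add: G.m_assoc[symmetric])
  have "J \<otimes>\<^bsub>G\<^esub> (h \<otimes>\<^bsub>G\<^esub> k) \<otimes>\<^bsub>G\<^esub> J = (J \<otimes>\<^bsub>G\<^esub> h \<otimes>\<^bsub>G\<^esub> J) \<otimes>\<^bsub>G\<^esub> (J \<otimes>\<^bsub>G\<^esub> k \<otimes>\<^bsub>G\<^esub> J)"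
    using c by (simp add: G.m_assoc jj)
  then show ?case using generate.eng[OF eng(3,4)] by simp
qed

text \<open>The group generated by \<open>Mlt Q m\<close> and \<open>J\<close>. The two-coset form
  splits membership into two cases.\<close>

definition M :: "('a \<Rightarrow> 'a) set" where "M = Mlt Q m \<union> (\<otimes>\<^bsub>G\<^esub>) J ` Mlt Q m"

lemma subgroup_M: "subgroup M G"
  unfolding M_def
  by (rule G.subgroup_Un_involution_coset[OF subgroup_Mlt _ J_J J_normalizes_Mlt])
     (simp_all add: carrier_G J_Bij)

lemma M_Bij: "g \<in> M \<Longrightarrow> g \<in> Bij Q"
  using subgroup.mem_carrier[OF subgroup_M] carrier_G by simp

lemma J_M: "J \<in> M"
proof -
  have "J = J \<otimes>\<^bsub>G\<^esub> \<one>\<^bsub>G\<^esub>" using J_Bij carrier_G by simp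
  then show ?thesis unfolding M_def using subgroup.one_closed[OF subgroup_Mlt] by blast
qed

text \<open>An element of \<open>Mlt Q m\<close> fixing \<open>e\<close> is an automorphism, so it
  commutes with inversion. If \<open>J \<otimes> h\<close> fixes \<open>e\<close>, then so does
  \<open>h\<close>, because only \<open>e\<close> has inverse \<open>e\<close>.\<close>

lemma stabilizer_commutes_J:
  assumes g: "g \<in> M" "g e = e"
  shows "g \<otimes>\<^bsub>G\<^esub> J = J \<otimes>\<^bsub>G\<^esub> g"
proof -
  have *: "h \<otimes>\<^bsub>G\<^esub> J = J \<otimes>\<^bsub>G\<^esub> h" if h: "h \<in> Mlt Q m" "h e = e" for h
  proof (rule Bij_eqI)
    show "h \<otimes>\<^bsub>G\<^esub> J \<in> Bij Q" "J \<otimes>\<^bsub>G\<^esub> h \<in> Bij Q"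
      using Mlt_Bij[OF h(1)] J_Bij G.m_closed carrier_G by auto
    have "mlt_map h" unfolding mlt_map_def using h(1) by auto
    then show "(h \<otimes>\<^bsub>G\<^esub> J) x = (J \<otimes>\<^bsub>G\<^esub> h) x" if "x \<in> Q" for x
      using that inner_iv[of h x] h Mlt_Bij[OF h(1)] J_Bij by (simp add: mult_apply Bij_apply)
  qed
  show ?thesis
  proof (cases "g \<in> Mlt Q m")
    case True then show ?thesis using g(2) by (rule *)
  next
    case False
    then obtain h where h: "h \<in> Mlt Q m" "g = J \<otimes>\<^bsub>G\<^esub> h" using g(1) unfolding M_def by auto
    have hB: "h \<in> Bij Q" using Mlt_Bij h(1) .
    have "iv (h e) = e" using g(2) h(2) hB J_Bij by (simp add: mult_apply Bij_apply)
    then have "h e = e" using Bij_apply[OF hB e_closed] right_iv[of "h e"] by simp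
    then have "h \<otimes>\<^bsub>G\<^esub> J = J \<otimes>\<^bsub>G\<^esub> h" by (rule *[OF h(1)])
    then show ?thesis using h(2) hB J_Bij carrier_G by (simp add: G.m_assoc)
  qed
qed

lemma transitive_action_M: "transitive_action (G\<lparr>carrier := M\<rparr>) Q (\<lambda>g. g)"
proof (intro transitive_action.intro transitive_action_axioms.intro group_action.intro
    group_hom.intro group_hom_axioms.intro group_BijGroup homI)
  show "group (G\<lparr>carrier := M\<rparr>)" by (rule G.subgroup_imp_group[OF subgroup_M])
  fix x y assume xy: "x \<in> Q" "y \<in> Q"
  have "Ltr Q m (rdiv y x) \<in> M" unfolding M_def using Ltr_Mlt xy by simp
  moreover have "Ltr Q m (rdiv y x) x = y" using xy by (simp add: Ltr_def)
  ultimately show "\<exists>g\<in>carrier (G\<lparr>carrier := M\<rparr>). g x = y" by auto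
qed (use M_Bij carrier_G in auto)

section \<open>Quotient loops from orbits of normalized subgroups\<close>

text \<open>Because \<open>Mlt Q m\<close> normalizes \<open>N\<close>, translations and divisions
  respect the partition of \<open>Q\<close> into \<open>N\<close>-orbits. The orbits therefore form
  a quotient loop, and the kernel of the projection is the orbit of \<open>e\<close>.\<close>

lemma normal_subloop_orbit:
  assumes N: "subgroup N G"
    and normal: "\<And>g n. g \<in> Mlt Q m \<Longrightarrow> n \<in> N \<Longrightarrow> g \<otimes>\<^bsub>G\<^esub> n \<otimes>\<^bsub>G\<^esub> inv\<^bsub>G\<^esub> g \<in> N"
  shows "normal_subloop Q m e {n e | n. n \<in> N}"
proof -
  have NB: "n \<in> Bij Q" if "n \<in> N" for n using subgroup.mem_carrier[OF N that] carrier_G by simp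
  define cls where "cls x = {n x | n. n \<in> N}" for x
  have one: "\<one>\<^bsub>G\<^esub> x = x" if "x \<in> Q" for x using that by (simp add: BijGroup_def)
  have clsI: "n x \<in> cls x" if "n \<in> N" for n x
    unfolding cls_def using that by (intro CollectI exI[of _ n]) simp
  have refl: "x \<in> cls x" if "x \<in> Q" for x
    using clsI[OF subgroup.one_closed[OF N], of x] one[OF that] by simp
  have closed': "y \<in> Q" if "x \<in> Q" "y \<in> cls x" for x y
    using that NB Bij_apply unfolding cls_def by auto
  have trans: "z \<in> cls x" if x: "x \<in> Q" and y: "y \<in> cls x" and z: "z \<in> cls y" for x y z
  proof -
    obtain n k where n: "n \<in> N" "y = n x" and k: "k \<in> N" "z = k y"
      using y z unfolding cls_def by auto
    then have "z = (k \<otimes>\<^bsub>G\<^esub> n) x" using x NB by (simp add: mult_apply)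
    then show ?thesis using clsI[OF subgroup.m_closed[OF N k(1) n(1)]] by simp
  qed
  have sym: "x \<in> cls y" if x: "x \<in> Q" and y: "y \<in> cls x" for x y
  proof -
    obtain n where n: "n \<in> N" "y = n x" using y unfolding cls_def by auto
    then have "(inv\<^bsub>G\<^esub> n) y = x" using x NB by (simp add: inv_apply)
    then show ?thesis using clsI[OF subgroup.m_inv_closed[OF N n(1)], of y] by simp
  qed
  have cls_eq: "cls x = cls y \<longleftrightarrow> y \<in> cls x" if "x \<in> Q" "y \<in> Q" for x y
    using that refl trans sym by blast
  \<comment> \<open>If \<open>n\<close> moves \<open>x\<close> to \<open>y\<close>, then the
    conjugate of \<open>n\<close> by \<open>g\<close> moves \<open>g x\<close> to
    \<open>g y\<close>.\<close>
  have mono: "f y \<in> cls (f x)" if f: "mlt_map f" and x: "x \<in> Q" and y: "y \<in> cls x" for f x y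
  proof -
    obtain g where g: "g \<in> Mlt Q m" "\<forall>x\<in>Q. g x = f x" using f mlt_map_def by auto
    have gB: "g \<in> Bij Q" using Mlt_Bij g(1) .
    obtain n where n: "n \<in> N" "y = n x" using y unfolding cls_def by auto
    have iB: "inv\<^bsub>G\<^esub> g \<in> Bij Q" using G.inv_closed gB carrier_G by simp
    have gn: "g \<otimes>\<^bsub>G\<^esub> n \<in> Bij Q" using G.m_closed gB NB[OF n(1)] carrier_G by simp
    have "(g \<otimes>\<^bsub>G\<^esub> n \<otimes>\<^bsub>G\<^esub> inv\<^bsub>G\<^esub> g) (g x) = g (n x)"
      using x gB NB[OF n(1)] iB gn by (simp add: mult_apply Bij_apply inv_apply)
    then have "g y \<in> cls (g x)" using clsI[OF normal[OF g(1) n(1)], of "g x"] n(2) by simp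
    then show ?thesis using g(2) x closed'[OF x y] by simp
  qed
  \<comment> \<open>Multiplication through chosen representatives; changing one factor at a time,
    \<open>mono\<close> for translations shows that the choice does not matter.\<close>
  define m' where "m' A B = cls ((SOME a. a \<in> A) \<cdot> (SOME b. b \<in> B))" for A B
  have m': "m' (cls a) (cls b) = cls (a \<cdot> b)" if a: "a \<in> Q" and b: "b \<in> Q" for a b
  proof -
    let ?a = "SOME x. x \<in> cls a" and ?b = "SOME x. x \<in> cls b"
    have a': "?a \<in> cls a" using refl[OF a] by (rule someI)
    have b': "?b \<in> cls b" using refl[OF b] by (rule someI)
    have c: "?a \<in> Q" "?b \<in> Q" using closed' a a' b b' by auto
    have "?a \<cdot> b \<in> cls (a \<cdot> b)" using mono[OF mlt_map_right[OF b] a a'] .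
    moreover have "?a \<cdot> ?b \<in> cls (?a \<cdot> b)" using mono[OF mlt_map_left[OF c(1)] b b'] .
    ultimately have "?a \<cdot> ?b \<in> cls (a \<cdot> b)" using trans[OF closed[OF a b]] by blast
    then have "cls (a \<cdot> b) = cls (?a \<cdot> ?b)"
      using cls_eq[OF closed[OF a b] closed[OF c]] by simp
    then show ?thesis unfolding m'_def by simp
  qed
  \<comment> \<open>Cancellation between orbits needs more than cancellation in \<open>Q\<close>: it
    holds because left division, too, is induced by an element of \<open>Mlt Q m\<close> and so
    respects the orbits.\<close>
  have left: "cls x = cls y" if a: "a \<in> Q" and x: "x \<in> Q" and y: "y \<in> Q"
    and eq: "cls (a \<cdot> x) = cls (a \<cdot> y)" for a x y
    using mono[OF mlt_map_ldiv[OF a], of "a \<cdot> x" "a \<cdot> y"] refl[of "a \<cdot> y"] eq a x y cls_eq by simp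
  have mlt_map_rdiv: "mlt_map (\<lambda>x. rdiv x a)" if "a \<in> Q" for a
    by (rule mlt_map_inverse[OF mlt_map_right[OF that]]) (use that in auto)
  have right: "cls x = cls y" if a: "a \<in> Q" and x: "x \<in> Q" and y: "y \<in> Q"
    and eq: "cls (x \<cdot> a) = cls (y \<cdot> a)" for a x y
    using mono[OF mlt_map_rdiv[OF a], of "x \<cdot> a" "y \<cdot> a"] refl[of "y \<cdot> a"] eq a x y cls_eq by simp
  have "loop (cls ` Q) m' (cls e)"
    unfolding loop_def
  proof (intro conjI ballI)
    fix A B assume "A \<in> cls ` Q" "B \<in> cls ` Q"
    then obtain a b where a: "a \<in> Q" "A = cls a" and b: "b \<in> Q" "B = cls b" by auto
    show "m' A B \<in> cls ` Q" using a b m' by simp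
    show "\<exists>!X. X \<in> cls ` Q \<and> m' A X = B"
    proof (rule ex1I[of _ "cls (ldiv a b)"])
      show "cls (ldiv a b) \<in> cls ` Q \<and> m' A (cls (ldiv a b)) = B" using a b m' by simp
      fix X assume "X \<in> cls ` Q \<and> m' A X = B"
      then obtain x where x: "x \<in> Q" "X = cls x" "cls (a \<cdot> x) = cls b" using a b m' by auto
      then show "X = cls (ldiv a b)" using left[OF a(1) x(1), of "ldiv a b"] a b by simp
    qed
    show "\<exists>!X. X \<in> cls ` Q \<and> m' X A = B"
    proof (rule ex1I[of _ "cls (rdiv b a)"])
      show "cls (rdiv b a) \<in> cls ` Q \<and> m' (cls (rdiv b a)) A = B" using a b m' by simp
      fix X assume "X \<in> cls ` Q \<and> m' X A = B"
      then obtain x where x: "x \<in> Q" "X = cls x" "cls (x \<cdot> a) = cls b" using a b m' by auto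
      then show "X = cls (rdiv b a)" using right[OF a(1) x(1), of "rdiv b a"] a b by simp
    qed
  qed (auto simp: m')
  moreover have "loop_hom Q m (cls ` Q) m' cls" unfolding loop_hom_def using m' by auto
  moreover have "{n e | n. n \<in> N} = {x \<in> Q. cls x = cls e}"
  proof -
    have "{n e | n. n \<in> N} = cls e" by (simp add: cls_def)
    also have "\<dots> = {x \<in> Q. cls x = cls e}" using cls_eq[OF e_closed] closed'[OF e_closed] by (auto simp: eq_commute[of "cls _" "cls e"])
    finally show ?thesis .
  qed
  ultimately show ?thesis unfolding normal_subloop_def by blast
qed

end

section \<open>Simple automorphic 2-loops\<close>

theorem theorem3p7:
  fixes Q :: "'a set" and m :: "'a \<Rightarrow> 'a \<Rightarrow> 'a" and e :: 'a
  assumes "two_loop Q m e" and "automorphic_loop Q m e" and "simple_loop Q m e"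
  shows "(\<forall>x\<in>Q. \<forall>y\<in>Q. m x y = m y x) \<and> (\<forall>x\<in>Q. m x x = e)"
proof -
  interpret aut_loop Q m e by (rule aut_loop.intro[OF assms(2)])
  let ?GM = "G\<lparr>carrier := M\<rparr>"
  interpret M: transitive_action ?GM Q "\<lambda>g. g" by (rule transitive_action_M)
  interpret gM: group ?GM by (rule G.subgroup_imp_group[OF subgroup_M])
  obtain k where finQ: "finite Q" and k: "k \<ge> 1" "card Q = 2 ^ k"
    using assms(1) unfolding two_loop_def by auto
  have "Bij Q \<subseteq> Q \<rightarrow>\<^sub>E Q"
    by (auto simp: PiE_def Bij_apply Bij_imp_extensional)
  then have "M \<subseteq> Q \<rightarrow>\<^sub>E Q" using M_Bij by (meson subset_iff)
  then have finM: "finite (carrier ?GM)"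
    using finite_PiE[OF finQ, of "\<lambda>_. Q"] finQ finite_subset by simp
  \<comment> \<open>\<open>K\<close> is the class of \<open>M\<close>-conjugates of
    \<open>J\<close>, and \<open>N\<close> below is the normal closure of \<open>J\<close> in
    \<open>M\<close>.\<close>
  define K where "K = {g \<otimes>\<^bsub>?GM\<^esub> J \<otimes>\<^bsub>?GM\<^esub> inv\<^bsub>?GM\<^esub> g | g. g \<in> carrier ?GM}"
  define N where "N = generate ?GM K"
  have J: "J \<in> carrier ?GM" using J_M by simp
  \<comment> \<open>The 2-power order of \<open>Q\<close> enters here, together with the facts that
    \<open>J\<close> fixes \<open>e\<close> and commutes with the stabilizer of \<open>e\<close> in
    \<open>M\<close>.\<close>
  have "\<exists>y\<in>Q. \<forall>n\<in>N. n e \<noteq> y"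
    unfolding N_def K_def
    by (rule M.conjugates_of_central_involution_of_stabilizer_intransitive[OF finM k(2,1) e_closed J])
       (use J_J stabilizer_commutes_J iv_unique[of e e] in auto)
  then have proper: "{n e | n. n \<in> N} \<noteq> Q" by blast
  have Kc: "K \<subseteq> carrier ?GM" unfolding K_def using J by blast
  have "N \<lhd> ?GM" unfolding N_def
  proof (rule gM.normal_generateI[OF Kc])
    fix h g assume "h \<in> K" and g: "g \<in> carrier ?GM"
    then obtain f where f: "f \<in> carrier ?GM" "h = f \<otimes>\<^bsub>?GM\<^esub> J \<otimes>\<^bsub>?GM\<^esub> inv\<^bsub>?GM\<^esub> f"
      unfolding K_def by blast
    have "g \<otimes>\<^bsub>?GM\<^esub> h \<otimes>\<^bsub>?GM\<^esub> inv\<^bsub>?GM\<^esub> g = (g \<otimes>\<^bsub>?GM\<^esub> f) \<otimes>\<^bsub>?GM\<^esub> J \<otimes>\<^bsub>?GM\<^esub> inv\<^bsub>?GM\<^esub> (g \<otimes>\<^bsub>?GM\<^esub> f)"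
      unfolding f(2) gM.inv_mult_group[OF g f(1)]
      using g f(1) J gM.m_assoc gM.m_closed gM.inv_closed by presburger
    then show "g \<otimes>\<^bsub>?GM\<^esub> h \<otimes>\<^bsub>?GM\<^esub> inv\<^bsub>?GM\<^esub> g \<in> K"
      unfolding K_def using gM.m_closed[OF g f(1)] by blast
  qed
  then have N: "subgroup N ?GM" "\<And>g n. g \<in> M \<Longrightarrow> n \<in> N \<Longrightarrow> g \<otimes>\<^bsub>?GM\<^esub> n \<otimes>\<^bsub>?GM\<^esub> inv\<^bsub>?GM\<^esub> g \<in> N"
    using gM.normal_inv_iff by auto
  have NG: "subgroup N G" by (rule G.incl_subgroup[OF subgroup_M N(1)])
  have inv_eq: "inv\<^bsub>?GM\<^esub> g = inv\<^bsub>G\<^esub> g" if "g \<in> M" for g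
    using G.m_inv_consistent[OF subgroup_M that] .
  have "normal_subloop Q m e {n e | n. n \<in> N}"
    by (rule normal_subloop_orbit[OF NG]) (use N(2) inv_eq in \<open>auto simp: M_def\<close>)
  \<comment> \<open>Simplicity leaves only \<open>{e}\<close> or \<open>Q\<close> for this orbit,
    and intransitivity excludes \<open>Q\<close>.\<close>
  then have orbit: "{n e | n. n \<in> N} = {e}"
    using assms(3) proper unfolding simple_loop_def by blast
  \<comment> \<open>The conjugate of \<open>J\<close> by \<open>?R\<close> lies in \<open>N\<close>
    and so fixes \<open>e\<close>; but it takes \<open>e\<close> to \<open>iv x\<close>, then to
    \<open>x\<close>, then to \<open>x \<cdot> x\<close>.\<close>
  have square: "m x x = e" if x: "x \<in> Q" for x
  proof -
    let ?R = "Rtr Q m x"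
    have R: "?R \<in> M" unfolding M_def using Rtr_Mlt x by simp
    have RB: "?R \<in> Bij Q" using M_Bij[OF R] .
    have "?R \<otimes>\<^bsub>G\<^esub> J \<otimes>\<^bsub>G\<^esub> inv\<^bsub>G\<^esub> ?R \<in> K"
      unfolding K_def using R inv_eq[OF R] by force
    then have "?R \<otimes>\<^bsub>G\<^esub> J \<otimes>\<^bsub>G\<^esub> inv\<^bsub>G\<^esub> ?R \<in> N" unfolding N_def by (rule generate.incl)
    then have "(?R \<otimes>\<^bsub>G\<^esub> J \<otimes>\<^bsub>G\<^esub> inv\<^bsub>G\<^esub> ?R) e = e" using orbit by blast
    moreover have "(inv\<^bsub>G\<^esub> ?R) e = iv x"
      using inv_apply[OF RB, of "iv x"] x by (simp add: Rtr_def)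
    moreover have "inv\<^bsub>G\<^esub> ?R \<in> Bij Q" "?R \<otimes>\<^bsub>G\<^esub> J \<in> Bij Q"
      using RB J_Bij G.inv_closed G.m_closed carrier_G by auto
    ultimately show ?thesis using x RB J_Bij by (simp add: mult_apply) (simp add: Rtr_def)
  qed
  \<comment> \<open>With inversion trivial, the antiautomorphic inverse property
    \<open>iv_mult\<close> becomes commutativity.\<close>
  have "iv x = x" if "x \<in> Q" for x using iv_unique[of x x] square that by simp
  then have "m x y = m y x" if "x \<in> Q" "y \<in> Q" for x y
    using iv_mult[of x y] that by simp
  then show ?thesis using square by blast
qed

end
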